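(* Let $C=\prod_{j=1}^\infty(1+2^{1-2^{j-1}})\approx3.40147$. For the depths $D^{\mathrm{GPF}}_z(n)$ and $D^{\mathrm{GPF}}_{\mathrm{CNOT}}(n)$ defined by the recurrences in the context, the subsequences $n=2^\lambda$ and $n=2^\lambda-1$ (along which the normalized depths $D/(2^n/n)$ tend to $C$ and $2(C-1)$ respectively) are the lower and upper envelopes of the normalized depth. Hence, for every $n$, $$D^{\mathrm{GPF}}_z(n),\ D^{\mathrm{GPF}}_{\mathrm{CNOT}}(n)\ \le\ \bigl(2(C-1)+o(1)\bigr)\frac{2^n}{n},$$ with the bound approached along $n=2^\lambda-1$ and improved to the constant $C$ along $n=2^\lambda$. Here $o(1)\to0$ as $n\to\infty$ (the normalized depth approaches the constant $2(C-1)$ from below).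
   Context: With $n_H=\lceil n/2\rceil$, $n_L=\lfloor n/2\rfloor$, the phase and CNOT depths of the recursive circuit constructions $\mathrm{GPF}$ and $\mathrm{GPF}^*$ for $n$-qubit diagonal unitaries under all-to-all connectivity are given by $D^{\mathrm{GPF}^*}_z(1)=D^{\mathrm{GPF}}_z(1)=1$, $D^{\mathrm{GPF}^*}_{\mathrm{CNOT}}(1)=D^{\mathrm{GPF}}_{\mathrm{CNOT}}(1)=0$, and for $n\ge2$ $$\begin{aligned} D^{\mathrm{GPF}^*}_z(n)&=2^{n_H-1}D^{\mathrm{GPF}^*}_z(n_L)+D^{\mathrm{GPF}^*}_z(n_H),\\ D^{\mathrm{GPF}^*}_{\mathrm{CNOT}}(n)&=\kappa\,D^{\mathrm{GPF}^*}_z(n)+D^{\mathrm{GPF}^*}_{\mathrm{CNOT}}(n_H)+D^{\mathrm{GPF}^*}_{\mathrm{CNOT}}(n_L),\\ D^{\mathrm{GPF}}_z(n)&=2^{n_H}D^{\mathrm{GPF}^*}_z(n_L)+D^{\mathrm{GPF}}_z(n_H),\\ D^{\mathrm{GPF}}_{\mathrm{CNOT}}(n)&=D^{\mathrm{GPF}}_z(n)+D^{\mathrm{GPF}}_{\mathrm{CNOT}}(n_H)+D^{\mathrm{GPF}^*}_{\mathrm{CNOT}}(n_L). \end{aligned}$$ Here $\kappa\in[3,4]$ is the fold factor of the Gray-code transition sequence used (a number possibly depending on $n_H$; $\kappa=3$ for the binary reflected Gray code). "Lower/upper envelope" means that the normalized depth $D(n)/(2^n/n)$ oscillates between these two subsequences,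 so that for large $n$ it is bracketed by their limiting constants up to $o(1)$. *)

theory Defs
  imports "HOL-Analysis.Analysis"
begin

definition nH :: "nat \<Rightarrow> nat" where
  "nH n = nat \<lceil>real n / 2\<rceil>"

definition nL :: "nat \<Rightarrow> nat" where
  "nL n = nat \<lfloor>real n / 2\<rfloor>"

lemma nL_eq: "nL n = n div 2"
  unfolding nL_def by (metis floor_divide_of_nat_eq nat_int of_nat_numeral)

lemma nH_eq: "nH n = (n + 1) div 2"
proof -
  have "\<lceil>real n / 2\<rceil> = int ((n + 1) div 2)"
    by (rule ceiling_unique; cases "even n"; auto elim!: evenE oddE)
  then show ?thesis by (simp add: nH_def)
qed

lemma nH_less: "2 \<le> n \<Longrightarrow> nH n < n"
  by (simp add: nH_eq)

lemma nL_less: "2 \<le> n \<Longrightarrow> nL n < n"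
  by (simp add: nL_eq)

(* In the four recurrences the value at n = 0 is a dummy: n_H and n_L are
   positive for n >= 2, so it is never reached from an argument n >= 1. *)

function Dz_GPF_star :: "nat \<Rightarrow> nat" where
  "Dz_GPF_star n =
     (if n < 2 then 1
      else 2 ^ (nH n - 1) * Dz_GPF_star (nL n) + Dz_GPF_star (nH n))"
  by auto
termination
  by (relation "Wellfounded.measure id") (auto simp: nH_less nL_less)

function Dz_GPF :: "nat \<Rightarrow> nat" where
  "Dz_GPF n =
     (if n < 2 then 1
      else 2 ^ nH n * Dz_GPF_star (nL n) + Dz_GPF (nH n))"
  by auto
termination
  by (relation "Wellfounded.measure id") (auto simp: nH_less)

(* \<kappa> m is the fold factor of the Gray code used when n_H = m. *)

function Dcnot_GPF_star :: "(nat \<Rightarrow> real) \<Rightarrow> nat \<Rightarrow> real" where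
  "Dcnot_GPF_star \<kappa> n =
     (if n < 2 then 0
      else \<kappa> (nH n) * real (Dz_GPF_star n)
           + Dcnot_GPF_star \<kappa> (nH n) + Dcnot_GPF_star \<kappa> (nL n))"
  by auto
termination
  by (relation "Wellfounded.measure snd") (auto simp: nH_less nL_less)

function Dcnot_GPF :: "(nat \<Rightarrow> real) \<Rightarrow> nat \<Rightarrow> real" where
  "Dcnot_GPF \<kappa> n =
     (if n < 2 then 0
      else real (Dz_GPF n) + Dcnot_GPF \<kappa> (nH n) + Dcnot_GPF_star \<kappa> (nL n))"
  by auto
termination
  by (relation "Wellfounded.measure snd") (auto simp: nH_less)

(* These equations loop as simplification rules. *)
declare Dz_GPF_star.simps [simp del] Dz_GPF.simps [simp del]
  Dcnot_GPF_star.simps [simp del] Dcnot_GPF.simps [simp del]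

(* The factors 1 + 2^(1 - 2^(j-1)) for j = 1, 2, ..., with j shifted to start at 0. *)
definition C_factor :: "nat \<Rightarrow> real" where
  "C_factor j = 1 + 2 powr (1 - 2 ^ j)"

definition C_GPF :: real where
  "C_GPF = prodinf C_factor"

definition normalized :: "(nat \<Rightarrow> real) \<Rightarrow> nat \<Rightarrow> real" where
  "normalized D n = D n / (2 ^ n / real n)"

(* f oscillates between its subsequences along lo and up: these converge to
   cl and cu, and f is bracketed by cl and cu up to o(1). *)
definition has_envelopes ::
  "(nat \<Rightarrow> real) \<Rightarrow> (nat \<Rightarrow> nat) \<Rightarrow> real \<Rightarrow> (nat \<Rightarrow> nat) \<Rightarrow> real \<Rightarrow> bool" where
  "has_envelopes f lo cl up cu \<longleftrightarrow>
     (\<lambda>k. f (lo k)) \<longlonglongrightarrow> cl \<and>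
     (\<lambda>k. f (up k)) \<longlonglongrightarrow> cu \<and>
     (\<exists>e. e \<longlonglongrightarrow> 0 \<and> (\<forall>n\<ge>1. cl - e n \<le> f n \<and> f n \<le> cu + e n))"

end

theory Submission
  imports Defs "HOL-Real_Asymp.Real_Asymp"
begin

text \<open>
  The depth of GPF is tied to that of GPF* by \<open>D\<^sub>z = 2 D\<^sub>z\<^sup>* - 1\<close>, and the additional CNOT layers are
  of order \<open>2\<^bsup>n/2\<^esup>\<close>, so everything reduces to \<open>u n = D\<^sub>z\<^sup>* n / 2\<^sup>n\<close>. Write \<open>p k\<close> for the partial
  products of \<open>C\<close>. Then \<open>2\<^sup>k u (2\<^sup>k) = p k / 2\<close> and \<open>2\<^sup>k u (2\<^sup>k - 1) = p k - 1\<close> exactly. Off these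
  two subsequences, one odd step in the binary expansion multiplies \<open>n u n\<close> by at least
  \<open>1 + 1/(2 m)\<close>, which beats the doubly exponentially small tail of the product; one even step
  multiplies \<open>(n + 1) u n\<close> by about \<open>1 - 1/(2 m + 2)\<close>, which beats the exponentially small later
  increments. Hence \<open>C/2 \<le> n u n\<close> unless \<open>n\<close> is a power of two, and \<open>(n + 1) u n \<le> C - 1\<close>.
\<close>

section \<open>Partial products of \<open>C\<close> and a numerical enclosure\<close>

definition partial_C :: "nat \<Rightarrow> real" where
  "partial_C k = (\<Prod>j<k. C_factor j)"

text \<open>This is \<open>u n\<close>; the normalized depth of GPF* is \<open>n * u n\<close>. The
  linear factor is left out because the two envelopes call for different weights, \<open>n\<close>
  below and \<open>n + 1\<close> above.\<close>

definition scaled_star :: "nat \<Rightarrow> real" where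
  "scaled_star n = real (Dz_GPF_star n) / 2 ^ n"

lemma C_factor_eq: "C_factor j = 1 + 2 / 2 ^ 2 ^ j"
proof -
  have "(2::real) powr (2 ^ j) = 2 ^ 2 ^ j"
    using powr_realpow[of 2 "2 ^ j"] by simp
  then show ?thesis
    by (simp add: C_factor_def powr_diff)
qed

lemma C_factor_gt_1: "1 < C_factor j"
  by (simp add: C_factor_eq)

lemma partial_C_0 [simp]: "partial_C 0 = 1"
  by (simp add: partial_C_def)

lemma partial_C_Suc: "partial_C (Suc k) = partial_C k * (1 + 2 / 2 ^ 2 ^ k)"
  by (simp add: partial_C_def C_factor_eq)

lemma partial_C_pos: "0 < partial_C k"
  unfolding partial_C_def using C_factor_gt_1 by (intro prod_pos) (smt (verit))

lemma partial_C_mono: "incseq partial_C"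
  by (rule incseq_SucI) (simp add: partial_C_Suc partial_C_pos less_imp_le)

lemma C_factor_has_prod: "C_factor has_prod C_GPF"
proof -
  have "summable (\<lambda>j. 2 / 2 ^ 2 ^ j :: real)"
  proof (rule summable_comparison_test')
    show "summable (\<lambda>j. 2 * (1 / 2 :: real) ^ j)"
      by (intro summable_mult summable_geometric) simp
    fix j :: nat
    have "(2::real) ^ j \<le> 2 ^ 2 ^ j"
      by (rule power_increasing) (auto intro: less_imp_le less_exp)
    then show "norm (2 / 2 ^ 2 ^ j :: real) \<le> 2 * (1 / 2) ^ j"
      by (simp add: power_one_over field_simps)
  qed
  then have "convergent_prod (\<lambda>j. 1 + 2 / 2 ^ 2 ^ j :: real)"
    by (intro abs_convergent_prod_imp_convergent_prod summable_imp_abs_convergent_prod) simp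
  then have "convergent_prod C_factor"
    by (simp add: C_factor_eq[abs_def])
  then show ?thesis
    unfolding C_GPF_def by (rule convergent_prod_has_prod)
qed

lemma partial_C_tendsto: "partial_C \<longlonglongrightarrow> C_GPF"
  using has_prod_imp_tendsto'[OF C_factor_has_prod] by (simp add: partial_C_def[abs_def])

lemma partial_C_le: "partial_C k \<le> C_GPF"
  using partial_C_mono partial_C_tendsto by (rule incseq_le)

text \<open>With \<open>x = 2\<^bsup>-2^k\<^esup> \<le> 1/4\<close>, the right-hand side decreases in \<open>k\<close> because
  \<open>(1 + 2 x) (1 + 4 x\<^sup>2) \<le> 1 + 4 x\<close>.\<close>

lemma C_GPF_le_partial:
  assumes "1 \<le> k"
  shows "C_GPF \<le> partial_C k * (1 + 4 / 2 ^ 2 ^ k)"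
proof -
  \<comment> \<open>The index starts at \<open>k\<close> so that every term falls under
    \<open>x <= 1/4\<close>; a decreasing sequence with limit \<open>C_GPF\<close> starts above
    it.\<close>
  define q where "q i = partial_C (i + k) * (1 + 4 / 2 ^ 2 ^ (i + k))" for i
  have "decseq q"
  proof (rule decseq_SucI)
    fix i
    define x where "x = (1 / 2 ^ 2 ^ (i + k) :: real)"
    have "(2::nat) ^ 1 \<le> 2 ^ (i + k)"
      using assms by (intro power_increasing) auto
    then have "(2::real) ^ 2 \<le> 2 ^ 2 ^ (i + k)"
      by (intro power_increasing) auto
    then have x: "0 < x" "x \<le> 1 / 4"
      unfolding x_def by (auto simp: field_simps)
    have x2: "x\<^sup>2 = 1 / 2 ^ 2 ^ (Suc i + k)"
      by (simp add: x_def power_divide power_mult [symmetric] mult.commute)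
    have "x * x \<le> x * (1 / 4)"
      using x by (intro mult_left_mono) auto
    then have "2 * x + 4 * x\<^sup>2 \<le> 1"
      using x unfolding power2_eq_square by linarith
    then have "x * (2 * x + 4 * x\<^sup>2) \<le> x * 1"
      using x by (intro mult_left_mono) auto
    then have "(1 + 2 * x) * (1 + 4 * x\<^sup>2) \<le> 1 + 4 * x"
      using x by (simp add: algebra_simps power2_eq_square)
    then have "partial_C (i + k) * ((1 + 2 * x) * (1 + 4 * x\<^sup>2)) \<le> partial_C (i + k) * (1 + 4 * x)"
      by (intro mult_left_mono) (auto simp: partial_C_pos less_imp_le)
    then show "q (Suc i) \<le> q i"
      using x2 by (simp add: q_def partial_C_Suc x_def mult.assoc)
  qed
  moreover have "q \<longlonglongrightarrow> C_GPF"
  proof -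
    have *: "filterlim (\<lambda>i. i + k) sequentially sequentially"
      by (rule filterlim_add_const_nat_at_top)
    have "(\<lambda>j. 4 / 2 ^ 2 ^ j :: real) \<longlonglongrightarrow> 0"
      by real_asymp
    from tendsto_mult[OF partial_C_tendsto tendsto_add[OF tendsto_const[of 1] this]]
    have "(\<lambda>j. partial_C j * (1 + 4 / 2 ^ 2 ^ j)) \<longlonglongrightarrow> C_GPF"
      by simp
    from filterlim_compose[OF this *] show ?thesis
      by (simp add: q_def[abs_def])
  qed
  ultimately have "C_GPF \<le> q 0"
    by (rule decseq_ge)
  then show ?thesis
    by (simp add: q_def)
qed

text \<open>Five factors suffice: the remaining tail is at most the factor
  \<open>1 + 4 / 2^32\<close>.\<close>

lemma C_GPF_bounds: "3.4014705 \<le> C_GPF" "C_GPF \<le> 3.401472"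
proof -
  have p5: "partial_C 5 = 2 * (3 / 2) * (9 / 8) * (129 / 128) * (32769 / 32768)"
    by (simp add: partial_C_def C_factor_eq eval_nat_numeral)
  show "3.4014705 \<le> C_GPF"
    using partial_C_le[of 5] unfolding p5 by simp
  show "C_GPF \<le> 3.401472"
    using C_GPF_le_partial[of 5] unfolding p5 by simp
qed

section \<open>Recurrences for the scaled depth and its exact values on the two extremal
  subsequences\<close>

lemma scaled_star_1: "scaled_star 1 = 1 / 2" "scaled_star (Suc 0) = 1 / 2"
  by (simp_all add: scaled_star_def Dz_GPF_star.simps)

text \<open>Both halves equal \<open>m\<close>, so the step is purely multiplicative:
  \<open>n * u n\<close> gains the factor \<open>1 + 2 / 2^m\<close>, which for
  \<open>m = 2^k\<close> is the factor of \<open>C\<close> with index \<open>k\<close>.\<close>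

lemma scaled_star_even:
  assumes "1 \<le> m"
  shows "scaled_star (2 * m) = scaled_star m * (1 / 2 + 1 / 2 ^ m)"
proof -
  define P where "P = (2::real) ^ (m - 1)"
  have P: "0 < P" "2 ^ m = 2 * P" "2 ^ (2 * m) = 2 * P * (2 * P)"
    using assms by (simp_all add: P_def mult_2 power_add flip: power_Suc)
  have "Dz_GPF_star (2 * m) = 2 ^ (m - 1) * Dz_GPF_star m + Dz_GPF_star m"
    using assms by (subst Dz_GPF_star.simps) (simp add: nH_eq nL_eq)
  then have "real (Dz_GPF_star (2 * m)) = (P + 1) * real (Dz_GPF_star m)"
    by (simp add: P_def algebra_simps)
  then show ?thesis
    using P(1) unfolding scaled_star_def P(2,3) by (simp add: field_simps)
qed

text \<open>Now \<open>nH n - 1 = m\<close>, one more than in the even case, so the leading power is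
  \<open>2^m\<close> while \<open>n\<close> has also grown by one.\<close>

lemma scaled_star_odd:
  assumes "1 \<le> m"
  shows "scaled_star (2 * m + 1) = scaled_star m / 2 + scaled_star (m + 1) / 2 ^ m"
proof -
  define P where "P = (2::real) ^ m"
  have P: "0 < P" "2 ^ m = P" "2 ^ (m + 1) = 2 * P" "2 ^ (2 * m + 1) = 2 * (P * P)"
    by (simp_all add: P_def power_even_eq power2_eq_square)
  have "Dz_GPF_star (2 * m + 1) = 2 ^ m * Dz_GPF_star m + Dz_GPF_star (m + 1)"
    using assms by (subst Dz_GPF_star.simps) (simp add: nH_eq nL_eq)
  then have "real (Dz_GPF_star (2 * m + 1)) = P * real (Dz_GPF_star m) + real (Dz_GPF_star (m + 1))"
    by (simp add: P_def)
  then have "scaled_star (2 * m + 1)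
      = (P * real (Dz_GPF_star m) + real (Dz_GPF_star (m + 1))) / (2 * (P * P))"
    unfolding scaled_star_def P(4) by simp
  also have "\<dots> = real (Dz_GPF_star m) / P / 2 + real (Dz_GPF_star (m + 1)) / (2 * P) / P"
    using P(1) by (simp add: add_divide_distrib)
  finally show ?thesis
    unfolding scaled_star_def P(2,3) .
qed

lemma scaled_star_nonneg: "0 \<le> scaled_star n"
  by (simp add: scaled_star_def)

lemma scaled_star_pow2: "2 ^ k * scaled_star (2 ^ k) = partial_C k / 2"
proof (induction k)
  case 0
  then show ?case by (simp add: scaled_star_1)
next
  case (Suc k)
  have "2 ^ Suc k * scaled_star (2 ^ Suc k) = 2 ^ k * scaled_star (2 ^ k) * (1 + 2 / 2 ^ 2 ^ k)"
    using scaled_star_even[of "2 ^ k"] by (simp add: algebra_simps)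
  then show ?case
    by (simp add: Suc partial_C_Suc)
qed

text \<open>The halves of \<open>2^(k+1) - 1\<close> are \<open>2^k - 1\<close> and
  \<open>2^k\<close>, so the exact value at \<open>2^k\<close> feeds in. The increment it causes
  equals \<open>partial_C (k+1) - partial_C k\<close>, and the offset 1 persists from
  \<open>k = 1\<close>.\<close>

lemma scaled_star_pow2_minus_1:
  "1 \<le> k \<Longrightarrow> 2 ^ k * scaled_star (2 ^ k - 1) = partial_C k - 1"
proof (induction k rule: dec_induct)
  case base
  then show ?case by (simp add: scaled_star_1 partial_C_Suc)
next
  case (step k)
  have pos: "(2::nat) \<le> 2 ^ k"
    using power_increasing[of 1 k "2::nat"] step by simp
  then have "2 ^ Suc k - 1 = 2 * (2 ^ k - 1) + (1::nat)" "2 ^ k - 1 + 1 = (2::nat) ^ k"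
    by simp_all
  then have "2 ^ Suc k * scaled_star (2 ^ Suc k - 1)
      = 2 ^ k * scaled_star (2 ^ k - 1) + 2 * (2 ^ k * scaled_star (2 ^ k)) / 2 ^ (2 ^ k - 1)"
    using pos scaled_star_odd[of "2 ^ k - 1"] by (simp add: algebra_simps)
  also have "\<dots> = partial_C k - 1 + partial_C k / 2 ^ (2 ^ k - 1)"
    unfolding step.IH scaled_star_pow2 by simp
  also have "partial_C k / 2 ^ (2 ^ k - 1) = partial_C k * (2 / 2 ^ 2 ^ k)"
    by (simp add: field_simps flip: power_Suc)
  finally show ?case
    by (simp add: partial_C_Suc algebra_simps)
qed

section \<open>Upper bound with weight \<open>n + 1\<close>\<close>

text \<open>Induction scheme for both bounds: 8 to 15 is a full dyadic block, and halving anything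
  larger stays at 8 or above. A start below 8 would meet \<open>n = 5\<close>, where the upper bound
  with slack is false.\<close>

lemma nat_cases_8_16:
  fixes n :: nat
  assumes "8 \<le> n"
  obtains "n \<in> {8, 9, 10, 11, 12, 13, 14, 15}" | m where "8 \<le> m" "n = 2 * m" | m where "8 \<le> m" "n = 2 * m + 1"
proof (cases "n < 16")
  case True
  with assms have "n \<in> {8, 9, 10, 11, 12, 13, 14, 15}" by auto
  then show ?thesis by (rule that(1))
next
  case False
  show ?thesis
  proof (cases "even n")
    case True
    then obtain m where "n = 2 * m" ..
    with False show ?thesis by (intro that(2)[of m]) auto
  next
    case odd: False
    then obtain m where "n = 2 * m + 1" by (rule oddE)
    with False show ?thesis by (intro that(3)[of m]) auto
  qed
qed

lemma scaled_star_values: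
  "scaled_star 8 = 27 / 128" "scaled_star 9 = 27 / 128" "scaled_star 10 = 51 / 256"
  "scaled_star 11 = 101 / 512" "scaled_star 12 = 165 / 1024"
  "scaled_star 13 = 659 / 4096" "scaled_star 14 = 1235 / 8192" "scaled_star 15 = 2459 / 16384"
proof -
  note s = scaled_star_1
  have 2: "scaled_star 2 = 1 / 2" using scaled_star_even[of 1] s by simp
  have 3: "scaled_star 3 = 1 / 2" using scaled_star_odd[of 1] s 2 by (simp del: One_nat_def)
  have 4: "scaled_star 4 = 3 / 8" using scaled_star_even[of 2] 2 by simp
  have 5: "scaled_star 5 = 3 / 8" using scaled_star_odd[of 2] 2 3 by simp
  have 6: "scaled_star 6 = 5 / 16" using scaled_star_even[of 3] 3 by simp
  have 7: "scaled_star 7 = 19 / 64" using scaled_star_odd[of 3] 3 4 by simp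
  show 8: "scaled_star 8 = 27 / 128" using scaled_star_even[of 4] 4 by simp
  show 9: "scaled_star 9 = 27 / 128" using scaled_star_odd[of 4] 4 5 by simp
  show "scaled_star 10 = 51 / 256" using scaled_star_even[of 5] 5 by simp
  show "scaled_star 11 = 101 / 512" using scaled_star_odd[of 5] 5 6 by simp
  show "scaled_star 12 = 165 / 1024" using scaled_star_even[of 6] 6 by simp
  show "scaled_star 13 = 659 / 4096" using scaled_star_odd[of 6] 6 7 by simp
  show "scaled_star 14 = 1235 / 8192" using scaled_star_even[of 7] 7 by simp
  show "scaled_star 15 = 2459 / 16384" using scaled_star_odd[of 7] 7 8 by simp
qed

lemma power2_ge_32_mult: "8 \<le> m \<Longrightarrow> 32 * m \<le> (2::nat) ^ m"
  by (induction m rule: dec_induct) auto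

text \<open>The slack \<open>6 / 2\<^sup>n\<close> absorbs all later increments along odd steps; only the extremal
  subsequence, where \<open>(n + 1) u n = p k - 1\<close>, lacks it.\<close>

lemma scaled_star_upper:
  assumes "8 \<le> n"
  shows "real (n + 1) * scaled_star n \<le> C_GPF - 1"
    and "real (n + 1) * scaled_star n + 6 / 2 ^ n \<le> C_GPF - 1 \<or> (\<exists>k. n + 1 = 2 ^ k)"
proof -
  define c where "c = C_GPF - 1"
  have c: "2.4014705 \<le> c" "c \<le> 2.401472"
    using C_GPF_bounds by (simp_all add: c_def)
  have pow: "real (n + 1) * scaled_star n \<le> c" if n: "8 \<le> n" "n + 1 = 2 ^ k" for n k
  proof -
    have "k \<noteq> 0"
      using n by (intro notI) simp
    moreover have "n = 2 ^ k - 1"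
      using n by simp
    ultimately show ?thesis
      using scaled_star_pow2_minus_1[of k] partial_C_le[of k] n(2) by (simp add: c_def)
  qed
  have "real (n + 1) * scaled_star n + 6 / 2 ^ n \<le> c \<or> (\<exists>k. n + 1 = 2 ^ k)"
    using assms
  proof (induction n rule: less_induct)
    case (less n)
    \<comment> \<open>The slack is dropped here, so that the exceptional arguments are covered as
      well.\<close>
    have v: "real (m + 1) * scaled_star m \<le> c" if "m < n" "8 \<le> m" for m
    proof -
      have "0 \<le> (6 / 2 ^ m :: real)" by simp
      with less.IH[OF that] show ?thesis
        using pow[OF that(2)] by (smt (verit))
    qed
    have y: "real m * (1 / 2 ^ m) \<le> 1 / 32" "(1 / 2 ^ m :: real) \<le> 1 / 256" "0 < (1 / 2 ^ m :: real)"
      if "8 \<le> m" for m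
    proof -
      have "real (32 * m) \<le> real (2 ^ m)"
        by (rule of_nat_mono[OF power2_ge_32_mult[OF that]])
      then show "real m * (1 / 2 ^ m) \<le> 1 / 32"
        by (simp add: field_simps)
      have "(2::real) ^ 8 \<le> 2 ^ m"
        using that by (intro power_increasing) auto
      then show "(1 / 2 ^ m :: real) \<le> 1 / 256"
        by (simp add: field_simps)
    qed auto
    from less.prems show ?case
    proof (cases rule: nat_cases_8_16)
      case 1
      then show ?thesis
        \<comment> \<open>Only \<open>n = 15\<close> is exceptional, with
          \<open>15 + 1 = 2^4\<close>.\<close>
        using c by (auto simp: scaled_star_values intro: exI[of _ 4])
    next
      case (2 m)
      define y where "y = (1 / 2 ^ m :: real)"
      define t where "t = c / real (m + 1)"
      have y: "real m * y \<le> 1 / 32" "y \<le> 1 / 256" "0 < y"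
        using y[OF 2(1)] by (simp_all add: y_def)
      have t: "scaled_star m \<le> t"
        using v[of m] 2 by (simp add: t_def field_simps)
      have tm: "real (m + 1) * t = c"
        by (simp add: t_def)
      \<comment> \<open>Since \<open>n + 1 = 2 * (m + 1) - 1\<close>, the missing unit costs about
        \<open>t / 2\<close>. This loss has to pay for the growth \<open>2 * c * y\<close> and the
        new slack \<open>6 * y^2\<close>; after scaling by \<open>m + 1\<close> only the smallness
        of \<open>(m + 1) * y\<close> matters.\<close>
      have "real (m + 1) * (2 * c * y + 6 * y\<^sup>2) = (real m * y + y) * (2 * c + 6 * y)"
        by (simp add: algebra_simps power2_eq_square)
      also have "\<dots> \<le> (1 / 32 + 1 / 256) * (2 * c + 6 * y)"
        using y c by (intro mult_right_mono) auto
      also have "\<dots> \<le> c / 2"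
        using y c by simp
      also have "\<dots> = real (m + 1) * (t / 2)"
        using tm by simp
      finally have small: "2 * c * y + 6 * y\<^sup>2 \<le> t / 2"
        by (subst (asm) mult_le_cancel_left_pos) auto
      have "6 / 2 ^ n = 6 * y\<^sup>2"
        using 2 by (simp add: y_def power2_eq_square mult_2 power_add)
      moreover have "scaled_star n = scaled_star m * (1 / 2 + y)"
        using scaled_star_even[of m] 2 by (simp add: y_def)
      ultimately have "real (n + 1) * scaled_star n + 6 / 2 ^ n
          = (2 * real m + 1) * scaled_star m * (1 / 2 + y) + 6 * y\<^sup>2"
        using 2 by simp
      also have "\<dots> \<le> (2 * real m + 1) * t * (1 / 2 + y) + 6 * y\<^sup>2"
        using t y by (intro add_right_mono mult_right_mono mult_left_mono) auto
      also have "\<dots> = (real (m + 1) * t) * (1 + 2 * y) - t / 2 - t * y + 6 * y\<^sup>2"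
        by (simp add: algebra_simps)
      also have "\<dots> = c - t * y + (2 * c * y + 6 * y\<^sup>2 - t / 2)"
        unfolding tm by (simp add: algebra_simps)
      also have "\<dots> \<le> c"
      proof -
        have "0 \<le> t * y"
          using y c by (simp add: t_def)
        with small show ?thesis by linarith
      qed
      finally show ?thesis ..
    next
      case (3 m)
      define y where "y = (1 / 2 ^ m :: real)"
      have y: "y \<le> 1 / 256" "0 < y"
        using y[OF 3(1)] by (simp_all add: y_def)
      from 3 have "m < n" by simp
      \<comment> \<open>As \<open>n + 1 = 2 * (m + 1)\<close>, an exceptional \<open>m\<close>
        yields an exceptional \<open>n\<close>, and otherwise the slack of \<open>m\<close> is
        available.\<close>
      from less.IH[OF this 3(1)] show ?thesis
      proof
        assume "\<exists>k. m + 1 = 2 ^ k"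
        then obtain k where "m + 1 = 2 ^ k" ..
        with 3 have "n + 1 = 2 ^ Suc k" by simp
        then show ?thesis by blast
      next
        assume m: "real (m + 1) * scaled_star m + 6 / 2 ^ m \<le> c"
        have "real (m + 1) * scaled_star (m + 1) \<le> real (m + 1 + 1) * scaled_star (m + 1)"
          by (intro mult_right_mono) (auto simp: scaled_star_nonneg)
        also have "\<dots> \<le> c"
          using 3 by (intro v) auto
        \<comment> \<open>The origin of the constant 6: the slack \<open>6 * y\<close> must cover an
          increment of at most \<open>2 * c * y\<close>, where \<open>2 * c < 5\<close>, and the new
          slack \<open>3 * y^2\<close>.\<close>
        finally have "2 * (real (m + 1) * scaled_star (m + 1)) + 3 * y \<le> 6"
          using y c by simp
        then have "y * (2 * (real (m + 1) * scaled_star (m + 1)) + 3 * y) \<le> y * 6"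
          using y by (intro mult_left_mono) auto
        moreover have "real (n + 1) * scaled_star n + 6 / 2 ^ n
            = real (m + 1) * scaled_star m + y * (2 * (real (m + 1) * scaled_star (m + 1)) + 3 * y)"
        proof -
          have "6 / 2 ^ n = 3 * (y * y)"
            using 3 by (simp add: y_def power_even_eq power2_eq_square)
          moreover have "scaled_star n = scaled_star m / 2 + scaled_star (m + 1) * y"
            using scaled_star_odd[of m] 3 by (simp add: y_def)
          moreover have "real (n + 1) = 2 * real (m + 1)"
            using 3 by simp
          ultimately show ?thesis
            by (simp add: algebra_simps)
        qed
        ultimately show ?thesis
          using m by (simp add: y_def)
      qed
    qed
  qed
  then show "real (n + 1) * scaled_star n + 6 / 2 ^ n \<le> C_GPF - 1 \<or> (\<exists>k. n + 1 = 2 ^ k)"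
    by (simp add: c_def)
  moreover have "0 \<le> (6 / 2 ^ n :: real)" by simp
  ultimately show "real (n + 1) * scaled_star n \<le> C_GPF - 1"
    using pow[OF assms] unfolding c_def by (smt (verit))
qed

section \<open>Lower bound away from powers of two\<close>

text \<open>The tail is weakened to the factor \<open>1 + 1 / (2 * m)\<close>,
  \<open>m = 2^k\<close>, that a single odd step gains. The comparison reduces to
  \<open>k + 3 <= 2^k\<close>, true from \<open>k = 3\<close> on.\<close>

lemma C_GPF_le_partial_linear:
  assumes "3 \<le> k"
  shows "C_GPF \<le> partial_C k * (1 + 1 / (2 * 2 ^ k))"
proof -
  have "8 * 2 ^ k \<le> (2::nat) ^ 2 ^ k"
  proof -
    have "k + 3 \<le> 2 ^ k"
      using assms by (induction k rule: dec_induct) auto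
    then have "(2::nat) ^ (k + 3) \<le> 2 ^ 2 ^ k"
      by (intro power_increasing) auto
    then show ?thesis by (simp add: power_add)
  qed
  then have "real (8 * 2 ^ k) \<le> real (2 ^ 2 ^ k)"
    by (rule of_nat_mono)
  then have "4 / 2 ^ 2 ^ k \<le> (1 / (2 * 2 ^ k) :: real)"
    by (simp add: field_simps)
  then have "partial_C k * (1 + 4 / 2 ^ 2 ^ k) \<le> partial_C k * (1 + 1 / (2 * 2 ^ k))"
    by (intro mult_left_mono) (auto simp: partial_C_pos less_imp_le)
  with C_GPF_le_partial[of k] assms show ?thesis by simp
qed

text \<open>Neither kind of step decreases \<open>n * u n\<close>. Even steps keep powers of two
  among themselves; the first odd step away from one gains enough to replace
  \<open>partial_C k / 2\<close> by \<open>C_GPF / 2\<close>.\<close>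

lemma scaled_star_lower:
  assumes "8 \<le> n"
  shows "C_GPF / 2 \<le> real n * scaled_star n \<or> (\<exists>k. n = 2 ^ k)"
  using assms
proof (induction n rule: less_induct)
  case (less n)
  from less.prems show ?case
  proof (cases rule: nat_cases_8_16)
    case 1
    then show ?thesis
      using C_GPF_bounds by (auto simp: scaled_star_values intro: exI[of _ 3])
  next
    case (2 m)
    have "real n * scaled_star n = real m * scaled_star m * (1 + 2 / 2 ^ m)"
      using scaled_star_even[of m] 2 by (simp add: algebra_simps)
    moreover have "real m * scaled_star m * 1 \<le> real m * scaled_star m * (1 + 2 / 2 ^ m)"
      by (intro mult_left_mono) (auto simp: scaled_star_nonneg)
    ultimately have "real m * scaled_star m \<le> real n * scaled_star n"
      by (simp only: mult_1_right)
    moreover have "\<exists>k. n = 2 ^ k" if "m = 2 ^ k" for k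
      using that 2 by (intro exI[of _ "Suc k"]) simp
    moreover have "C_GPF / 2 \<le> real m * scaled_star m \<or> (\<exists>k. m = 2 ^ k)"
      using 2 by (intro less.IH) auto
    ultimately show ?thesis
      by (metis order_trans)
  next
    case (3 m)
    have "real m * scaled_star m * (1 + 1 / (2 * real m))
        = (2 * real m + 1) * (scaled_star m / 2)"
      using 3 by (simp add: field_simps)
    \<comment> \<open>The contribution of \<open>scaled_star (m + 1)\<close> is dropped.\<close>
    also have "\<dots> \<le> real n * scaled_star n"
      using scaled_star_odd[of m] 3 scaled_star_nonneg[of "m + 1"]
      by (intro mult_mono) (auto simp: scaled_star_nonneg)
    finally have step: "real m * scaled_star m * (1 + 1 / (2 * real m)) \<le> real n * scaled_star n" .
    from less.IH[of m] 3 consider "C_GPF / 2 \<le> real m * scaled_star m" | k where "m = 2 ^ k"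
      by auto
    then show ?thesis
    proof cases
      case 1
      have "real m * scaled_star m * 1 \<le> real m * scaled_star m * (1 + 1 / (2 * real m))"
        by (intro mult_left_mono) (auto simp: scaled_star_nonneg)
      with 1 step show ?thesis by simp
    next
      case (2 k)
      have "(2::nat) ^ 3 \<le> 2 ^ k"
        using 2 3 by simp
      then have "3 \<le> k"
        by (subst (asm) power_increasing_iff) auto
      from C_GPF_le_partial_linear[OF this]
      have "C_GPF / 2 \<le> real m * scaled_star m * (1 + 1 / (2 * real m))"
        unfolding 2 of_nat_power of_nat_numeral scaled_star_pow2 by simp
      with step show ?thesis by simp
    qed
  qed
qed

section \<open>From the bounds on the scaled depth to envelopes of perturbed sequences\<close>

text \<open>Powers of two may lie below \<open>C_GPF / 2\<close>, but only by a vanishing amount.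
  Phrased in \<open>n\<close> rather than \<open>k\<close> to combine with
  \<open>scaled_star_lower\<close>.\<close>

lemma eventually_pow2_near_limit:
  assumes "0 < \<epsilon>"
  shows "\<forall>\<^sub>F n in sequentially. \<forall>k. n = 2 ^ k \<longrightarrow> C_GPF / 2 - \<epsilon> < real n * scaled_star n"
proof -
  have "\<forall>\<^sub>F k in sequentially. C_GPF - 2 * \<epsilon> < partial_C k"
    using order_tendstoD(1)[OF partial_C_tendsto] assms by simp
  then obtain K where K: "\<And>k. K \<le> k \<Longrightarrow> C_GPF - 2 * \<epsilon> < partial_C k"
    unfolding eventually_sequentially by blast
  show ?thesis
    unfolding eventually_sequentially
  proof (intro exI allI impI)
    fix n k :: nat
    assume n: "2 ^ K \<le> n" "n = 2 ^ k"
    then have "K \<le> k"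
      by (metis power_increasing_iff one_less_numeral_iff semiring_norm(76))
    from K[OF this] show "C_GPF / 2 - \<epsilon> < real n * scaled_star n"
      using scaled_star_pow2[of k] n(2) by simp
  qed
qed

text \<open>The weight \<open>n + 1\<close> in the hypothesis serves strictness:
  \<open>(n + 1) * u n <= C_GPF - 1\<close> leaves \<open>2 * n * u n\<close> a gap of order
  \<open>1 / n\<close> below \<open>2 * (C_GPF - 1)\<close>, into which an error
  \<open>o(1/n)\<close> fits.\<close>

lemma limits_of_perturbation:
  fixes D :: "nat \<Rightarrow> real"
  assumes g: "(\<lambda>n. real (n + 1) * (normalized D n - 2 * (real n * scaled_star n))) \<longlonglongrightarrow> 0"
  shows "(\<lambda>l. normalized D (2 ^ l)) \<longlonglongrightarrow> C_GPF"
    and "(\<lambda>l. normalized D (2 ^ l - 1)) \<longlonglongrightarrow> 2 * (C_GPF - 1)"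
    and "\<forall>\<^sub>F n in sequentially. normalized D n < 2 * (C_GPF - 1)"
    and "0 < \<epsilon> \<Longrightarrow> \<forall>\<^sub>F n in sequentially. C_GPF - \<epsilon> < normalized D n"
proof -
  define g where "g n = normalized D n - 2 * (real n * scaled_star n)" for n
  note g = g[folded g_def]
  have g0: "g \<longlonglongrightarrow> 0"
  proof (rule Lim_null_comparison[OF _ tendsto_norm_zero[OF g]])
    show "\<forall>\<^sub>F n in sequentially. norm (g n) \<le> norm (real (n + 1) * g n)"
    proof (intro always_eventually allI)
      fix n
      have "1 * \<bar>g n\<bar> \<le> real (n + 1) * \<bar>g n\<bar>"
        by (intro mult_right_mono) auto
      then show "norm (g n) \<le> norm (real (n + 1) * g n)"
        by (simp add: abs_mult)
    qed
  qed
  have D: "normalized D n = 2 * (real n * scaled_star n) + g n" for n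
    by (simp add: g_def)
  have lim1: "filterlim (\<lambda>l. 2 ^ l :: nat) sequentially sequentially"
    by (rule filterlim_subseq) (auto simp: strict_mono_def)
  have lim2: "filterlim (\<lambda>l. 2 ^ l - 1 :: nat) sequentially sequentially"
    by (rule filterlim_subseq) (auto simp: strict_mono_def intro!: diff_less_mono)
  show "(\<lambda>l. normalized D (2 ^ l)) \<longlonglongrightarrow> C_GPF"
    unfolding D using tendsto_add[OF partial_C_tendsto filterlim_compose[OF g0 lim1]]
    by (simp add: scaled_star_pow2)
  have "(\<lambda>l. 2 * ((1 - 1 / 2 ^ l) * (partial_C l - 1)) + g (2 ^ l - 1)) \<longlonglongrightarrow> 2 * ((1 - 0) * (C_GPF - 1)) + 0"
    by (intro tendsto_intros partial_C_tendsto filterlim_compose[OF g0 lim2]) real_asymp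
  moreover have "\<forall>\<^sub>F l in sequentially.
      2 * ((1 - 1 / 2 ^ l) * (partial_C l - 1)) + g (2 ^ l - 1) = normalized D (2 ^ l - 1)"
    using eventually_ge_at_top[of 1]
  proof eventually_elim
    case (elim l)
    have "real (2 ^ l - 1) = (1 - 1 / 2 ^ l) * 2 ^ l"
      by (simp add: of_nat_diff algebra_simps)
    then have "real (2 ^ l - 1) * scaled_star (2 ^ l - 1) = (1 - 1 / 2 ^ l) * (partial_C l - 1)"
      unfolding scaled_star_pow2_minus_1[OF elim, symmetric] by simp
    then show ?case
      unfolding D by simp
  qed
  ultimately show "(\<lambda>l. normalized D (2 ^ l - 1)) \<longlonglongrightarrow> 2 * (C_GPF - 1)"
    by (auto dest: Lim_transform_eventually)
  have "\<forall>\<^sub>F n in sequentially. real (n + 1) * g n < 2"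
    using order_tendstoD(2)[OF g] by simp
  then show "\<forall>\<^sub>F n in sequentially. normalized D n < 2 * (C_GPF - 1)"
    using eventually_ge_at_top[of 8]
  proof eventually_elim
    case (elim n)
    have "real n * (real (n + 1) * scaled_star n) \<le> real n * (C_GPF - 1)"
      by (intro mult_left_mono scaled_star_upper elim) auto
    moreover have "real (n + 1) * normalized D n = 2 * (real n * (real (n + 1) * scaled_star n)) + real (n + 1) * g n"
      by (simp add: D algebra_simps)
    ultimately have "real (n + 1) * normalized D n < 2 * (real n * (C_GPF - 1)) + 2"
      using elim(1) by linarith
    \<comment> \<open>The added 2 is absorbed because \<open>C_GPF >= 2\<close>.\<close>
    also have "\<dots> \<le> real (n + 1) * (2 * (C_GPF - 1))"
      using C_GPF_bounds by (simp add: algebra_simps)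
    finally show ?case
      by (subst (asm) mult_less_cancel_left_pos) auto
  qed
  show "\<forall>\<^sub>F n in sequentially. C_GPF - \<epsilon> < normalized D n" if "0 < \<epsilon>"
  proof -
    have "\<forall>\<^sub>F n in sequentially. - (\<epsilon> / 2) < g n"
      using order_tendstoD(1)[OF g0] that by simp
    moreover have "\<forall>\<^sub>F n in sequentially. \<forall>k. n = 2 ^ k \<longrightarrow> C_GPF / 2 - \<epsilon> / 4 < real n * scaled_star n"
      using that by (intro eventually_pow2_near_limit) simp
    ultimately show ?thesis
      using eventually_ge_at_top[of 8]
    proof eventually_elim
      case (elim n)
      have "C_GPF / 2 - \<epsilon> / 4 < real n * scaled_star n"
        using scaled_star_lower[OF elim(3)] elim(2) that by force
      with elim(1) show ?case
        by (simp add: D)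
    qed
  qed
qed

lemma le_normalized:
  assumes "1 \<le> n" "normalized D n \<le> x"
  shows "D n \<le> x * (2 ^ n / real n)"
proof -
  have "D n = normalized D n * (2 ^ n / real n)"
    using assms(1) by (simp add: normalized_def)
  also have "\<dots> \<le> x * (2 ^ n / real n)"
    using assms(2) by (intro mult_right_mono) auto
  finally show ?thesis .
qed

lemma envelopes_of_perturbation:
  fixes D :: "nat \<Rightarrow> real"
  assumes g: "(\<lambda>n. real (n + 1) * (normalized D n - 2 * (real n * scaled_star n))) \<longlonglongrightarrow> 0"
  shows "has_envelopes (normalized D) (\<lambda>l. 2 ^ l) C_GPF (\<lambda>l. 2 ^ l - 1) (2 * (C_GPF - 1))"
    and "\<exists>e. e \<longlonglongrightarrow> 0 \<and> (\<forall>n\<ge>1. D n \<le> (2 * (C_GPF - 1) + e n) * (2 ^ n / real n))"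
    and "\<exists>e. e \<longlonglongrightarrow> 0 \<and> (\<forall>l. D (2 ^ l) \<le> (C_GPF + e l) * (2 ^ (2 ^ l) / real (2 ^ l)))"
    and "\<forall>\<^sub>F n in sequentially. normalized D n < 2 * (C_GPF - 1)"
proof -
  note lims = limits_of_perturbation[OF g]
  \<comment> \<open>The least nonnegative error for which the bracket holds at every
    \<open>n\<close>; only its convergence to 0 needs proof.\<close>
  define e where "e n = max 0 (max (C_GPF - normalized D n) (normalized D n - 2 * (C_GPF - 1)))" for n
  have e0: "e \<longlonglongrightarrow> 0"
  proof (rule order_tendstoI)
    fix a :: real
    assume "a < 0"
    then show "\<forall>\<^sub>F n in sequentially. a < e n"
      by (intro always_eventually allI) (simp add: e_def less_max_iff_disj)
  next
    fix a :: real
    assume a: "0 < a"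
    show "\<forall>\<^sub>F n in sequentially. e n < a"
      using lims(3) lims(4)[OF a] by eventually_elim (use a in \<open>simp add: e_def\<close>)
  qed
  have e: "C_GPF - e n \<le> normalized D n" "normalized D n \<le> 2 * (C_GPF - 1) + e n" for n
    by (auto simp: e_def)
  show "has_envelopes (normalized D) (\<lambda>l. 2 ^ l) C_GPF (\<lambda>l. 2 ^ l - 1) (2 * (C_GPF - 1))"
    unfolding has_envelopes_def using lims(1,2) e0 e by blast
  show "\<exists>e. e \<longlonglongrightarrow> 0 \<and> (\<forall>n\<ge>1. D n \<le> (2 * (C_GPF - 1) + e n) * (2 ^ n / real n))"
    using e0 le_normalized[OF _ e(2)] by blast
  show "\<exists>e. e \<longlonglongrightarrow> 0 \<and> (\<forall>l. D (2 ^ l) \<le> (C_GPF + e l) * (2 ^ (2 ^ l) / real (2 ^ l)))"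
  proof (intro exI conjI allI)
    show "(\<lambda>l. normalized D (2 ^ l) - C_GPF) \<longlonglongrightarrow> 0"
      using lims(1) by (simp add: LIM_zero)
    show "D (2 ^ l) \<le> (C_GPF + (normalized D (2 ^ l) - C_GPF)) * (2 ^ (2 ^ l) / real (2 ^ l))" for l
      by (rule le_normalized) auto
  qed
  show "\<forall>\<^sub>F n in sequentially. normalized D n < 2 * (C_GPF - 1)"
    by (rule lims(3))
qed

section \<open>The GPF depths as small perturbations of the GPF* phase depth\<close>

text \<open>Doubling the GPF* recurrence turns \<open>2^(nH n - 1)\<close> into
  \<open>2^nH n\<close>, so \<open>Dz_GPF n + 1\<close> and \<open>2 * Dz_GPF_star n\<close> obey
  the same recursion. The 1 is added on the left to avoid truncated subtraction.\<close>

lemma Dz_GPF_eq: "Dz_GPF n + 1 = 2 * Dz_GPF_star n"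
proof (induction n rule: less_induct)
  case (less n)
  show ?case
  proof (cases "n < 2")
    case True
    then show ?thesis
      by (simp add: Dz_GPF.simps[of n] Dz_GPF_star.simps[of n])
  next
    case False
    then have "(2::nat) ^ nH n = 2 * 2 ^ (nH n - 1)"
      by (simp add: nH_eq flip: power_Suc)
    with False less.IH[of "nH n"] nH_less[of n] show ?thesis
      by (simp add: Dz_GPF.simps[of n] Dz_GPF_star.simps[of n] algebra_simps)
  qed
qed

lemma nH_add_nL: "nH n + nL n = n"
  unfolding nH_eq nL_eq by presburger

lemma Dz_GPF_star_le: "1 \<le> n \<Longrightarrow> Dz_GPF_star n \<le> 2 ^ n"
proof (induction n rule: less_induct)
  case (less n)
  show ?case
  proof (cases "n < 2")
    case True
    then show ?thesis by (simp add: Dz_GPF_star.simps[of n])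
  next
    case False
    then have *: "Dz_GPF_star (nL n) \<le> 2 ^ nL n" "Dz_GPF_star (nH n) \<le> 2 ^ nH n"
      by (auto intro!: less.IH simp: nL_less nH_less) (auto simp: nL_eq nH_eq)
    have "Dz_GPF_star n \<le> 2 ^ (nH n - 1) * 2 ^ nL n + 2 ^ nH n"
      using False * by (subst Dz_GPF_star.simps) (auto intro!: add_mono)
    also have "2 ^ (nH n - 1) * 2 ^ nL n = (2::nat) ^ (n - 1)"
      using False nH_add_nL[of n] by (simp flip: power_add) (simp add: nH_eq)
    also have "(2::nat) ^ nH n \<le> 2 ^ (n - 1)"
      using False nH_less[of n] by (intro power_increasing) auto
    also have "(2::nat) ^ (n - 1) + 2 ^ (n - 1) = 2 ^ n"
      using False by (simp flip: mult_2 power_Suc)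
    finally show ?thesis by simp
  qed
qed

text \<open>Multiplied by 4, this yields the induction step for bounds \<open>16 * (2^n - 2)\<close>
  when the leading term is at most \<open>4 * 2^n\<close>.\<close>

lemma power2_split_bound:
  assumes "2 \<le> n"
  shows "(2::real) ^ n + 4 * 2 ^ nH n + 4 * 2 ^ nL n \<le> 4 * 2 ^ n + 4"
proof -
  define x y where "x = (2::real) ^ nH n" and "y = (2::real) ^ nL n"
  have "1 \<le> nH n" "1 \<le> nL n"
    using assms by (auto simp: nH_eq nL_eq)
  then have "(2::real) ^ 1 \<le> x" "(2::real) ^ 1 \<le> y"
    unfolding x_def y_def by (intro power_increasing; simp)+
  then have xy: "2 \<le> x" "2 \<le> y"
    by simp_all
  have "x * y = 2 ^ n"
    by (simp add: x_def y_def nH_add_nL flip: power_add)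
  \<comment> \<open>The expression expands to \<open>3 * x * y - 4 * x - 4 * y + 4\<close>, which
    vanishes at \<open>x = y = 2\<close>.\<close>
  moreover have "0 \<le> (x - 2) * (3 * y - 4) + 2 * (y - 2)"
    using xy by (intro add_nonneg_nonneg mult_nonneg_nonneg) auto
  ultimately show ?thesis
    by (simp add: algebra_simps flip: x_def y_def)
qed

text \<open>Subtracting 2 makes the bound exact at \<open>n = 1\<close>, where the depth is
  0.\<close>

lemma Dcnot_GPF_star_bounds:
  assumes kappa: "\<And>m. 3 \<le> \<kappa> m \<and> \<kappa> m \<le> 4"
  shows "1 \<le> n \<Longrightarrow> 0 \<le> Dcnot_GPF_star \<kappa> n \<and> Dcnot_GPF_star \<kappa> n \<le> 16 * (2 ^ n - 2)"
proof (induction n rule: less_induct)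
  case (less n)
  show ?case
  proof (cases "n < 2")
    case True
    with less.prems have "n = 1" by simp
    then show ?thesis by (simp add: Dcnot_GPF_star.simps[of \<kappa> 1] del: One_nat_def)
  next
    case False
    then have "nH n < n" "1 \<le> nH n" "nL n < n" "1 \<le> nL n"
      by (auto simp: nH_less nL_less) (auto simp: nH_eq nL_eq)
    note IH = less.IH[OF this(1,2)] less.IH[OF this(3,4)]
    have "real (Dz_GPF_star n) \<le> real (2 ^ n)"
      by (rule of_nat_mono[OF Dz_GPF_star_le[OF less.prems]])
    then have "\<kappa> (nH n) * real (Dz_GPF_star n) \<le> 4 * 2 ^ n"
      using kappa[of "nH n"] by (intro mult_mono) auto
    moreover have "0 \<le> \<kappa> (nH n) * real (Dz_GPF_star n)"
      using kappa[of "nH n"] by (intro mult_nonneg_nonneg) auto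
    ultimately show ?thesis
      using False IH power2_split_bound[of n] by (simp add: Dcnot_GPF_star.simps[of \<kappa> n])
  qed
qed

lemma Dcnot_GPF_bounds:
  assumes kappa: "\<And>m. 3 \<le> \<kappa> m \<and> \<kappa> m \<le> 4"
  shows "1 \<le> n \<Longrightarrow> 0 \<le> Dcnot_GPF \<kappa> n \<and> Dcnot_GPF \<kappa> n \<le> 16 * (2 ^ n - 2)"
proof (induction n rule: less_induct)
  case (less n)
  show ?case
  proof (cases "n < 2")
    case True
    with less.prems have "n = 1" by simp
    then show ?thesis by (simp add: Dcnot_GPF.simps[of \<kappa> 1] del: One_nat_def)
  next
    case False
    then have "nH n < n" "1 \<le> nH n" "1 \<le> nL n"
      by (auto simp: nH_less) (auto simp: nH_eq nL_eq)
    note IH = less.IH[OF this(1,2)] Dcnot_GPF_star_bounds[of \<kappa>, OF kappa this(3)]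
    have "real (Dz_GPF n) \<le> real (2 * 2 ^ n)"
      using Dz_GPF_star_le[OF less.prems] Dz_GPF_eq[of n] by (intro of_nat_mono) simp
    \<comment> \<open>Relaxed from 2 to 4 so that the same splitting inequality applies.\<close>
    then have "real (Dz_GPF n) \<le> 4 * 2 ^ n"
      by simp
    then show ?thesis
      using False IH power2_split_bound[of n] by (simp add: Dcnot_GPF.simps[of \<kappa> n])
  qed
qed

text \<open>The offset 1 in \<open>Dz_GPF_eq\<close> makes the error exactly
  \<open>- n / 2^n\<close>.\<close>

lemma Dz_GPF_perturbation:
  "(\<lambda>n. real (n + 1) * (normalized (\<lambda>n. real (Dz_GPF n)) n - 2 * (real n * scaled_star n))) \<longlonglongrightarrow> 0"
proof -
  have "normalized (\<lambda>n. real (Dz_GPF n)) n - 2 * (real n * scaled_star n) = - (real n / 2 ^ n)" for n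
  proof -
    have "real (Dz_GPF n) = 2 * real (Dz_GPF_star n) - 1"
      using arg_cong[OF Dz_GPF_eq[of n], of real] by simp
    then show ?thesis
      by (simp add: normalized_def scaled_star_def left_diff_distrib diff_divide_distrib)
  qed
  moreover have "(\<lambda>n. real (n + 1) * - (real n / 2 ^ n)) \<longlonglongrightarrow> 0"
    by real_asymp
  ultimately show ?thesis by simp
qed

text \<open>The CNOT depth exceeds the phase depth only by depths at \<open>nH n\<close> and
  \<open>nL n\<close>, hence by \<open>O(2^(n/2))\<close>, which remains negligible against
  \<open>2^n\<close> after two factors of order \<open>n\<close>.\<close>

lemma Dcnot_GPF_perturbation:
  assumes kappa: "\<And>m. 3 \<le> \<kappa> m \<and> \<kappa> m \<le> 4"
  shows "(\<lambda>n. real (n + 1) * (normalized (Dcnot_GPF \<kappa>) n - 2 * (real n * scaled_star n))) \<longlonglongrightarrow> 0"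
proof -
  define r where "r n = real (n + 1) * (normalized (Dcnot_GPF \<kappa>) n - normalized (\<lambda>n. real (Dz_GPF n)) n)" for n
  have "r \<longlonglongrightarrow> 0"
  proof (rule Lim_null_comparison)
    \<comment> \<open>The real exponent \<open>(n + 1) / 2\<close> dominates \<open>nH n\<close>
      without any rounding.\<close>
    show "(\<lambda>n. real (n + 1) * real n * (32 * 2 powr ((real n + 1) / 2)) / 2 ^ n) \<longlonglongrightarrow> 0"
      by real_asymp
    show "\<forall>\<^sub>F n in sequentially. norm (r n) \<le> real (n + 1) * real n * (32 * 2 powr ((real n + 1) / 2)) / 2 ^ n"
      using eventually_ge_at_top[of 2]
    proof eventually_elim
      case (elim n)
      define R where "R = Dcnot_GPF \<kappa> (nH n) + Dcnot_GPF_star \<kappa> (nL n)"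
      have pos: "1 \<le> nH n" "1 \<le> nL n"
        using elim by (auto simp: nH_eq nL_eq)
      have "(2::real) ^ nL n \<le> 2 ^ nH n"
        by (intro power_increasing) (auto simp: nH_eq nL_eq)
      then have "16 * (2 ^ nL n - 2) \<le> (16 * (2 ^ nH n - 2) :: real)"
        by (intro mult_left_mono diff_right_mono) auto
      with Dcnot_GPF_star_bounds[of \<kappa>, OF kappa pos(2)]
      have "0 \<le> Dcnot_GPF_star \<kappa> (nL n)" "Dcnot_GPF_star \<kappa> (nL n) \<le> 16 * (2 ^ nH n - 2)"
        by (blast intro: order_trans)+
      then have "0 \<le> R" "R \<le> 32 * 2 ^ nH n"
        using Dcnot_GPF_bounds[of \<kappa>, OF kappa pos(1)] by (auto simp: R_def)
      moreover have "(2::real) ^ nH n \<le> 2 powr ((real n + 1) / 2)"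
      proof -
        have "2 * nH n \<le> n + 1"
          by (simp add: nH_eq)
        then have "real (nH n) \<le> (real n + 1) / 2"
          by (simp add: field_simps)
        then have "2 powr real (nH n) \<le> 2 powr ((real n + 1) / 2)"
          by (intro powr_mono) auto
        then show ?thesis by (simp add: powr_realpow)
      qed
      ultimately have R: "0 \<le> R" "R \<le> 32 * 2 powr ((real n + 1) / 2)"
        by auto
      have "Dcnot_GPF \<kappa> n = real (Dz_GPF n) + R"
        using elim by (simp add: Dcnot_GPF.simps[of \<kappa> n] R_def)
      then have "r n = real (n + 1) * real n * R / 2 ^ n"
        by (simp add: r_def normalized_def field_simps)
      then have "norm (r n) = real (n + 1) * real n * R / 2 ^ n"
        using R(1) by simp
      also have "\<dots> \<le> real (n + 1) * real n * (32 * 2 powr ((real n + 1) / 2)) / 2 ^ n"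
        using R by (intro divide_right_mono mult_left_mono) auto
      finally show ?case .
    qed
  qed
  from tendsto_add[OF this Dz_GPF_perturbation] show ?thesis
    by (simp add: r_def algebra_simps)
qed

theorem corollary1:
  fixes \<kappa> :: "nat \<Rightarrow> real"
  assumes kappa: "\<And>m. 3 \<le> \<kappa> m \<and> \<kappa> m \<le> 4"
  shows "C_factor has_prod C_GPF \<and>
    \<bar>C_GPF - 3.40147\<bar> < 0.000005 \<and>
    (\<forall>D \<in> {\<lambda>n. real (Dz_GPF n), Dcnot_GPF \<kappa>}.
       has_envelopes (normalized D)
         (\<lambda>l. 2 ^ l) C_GPF (\<lambda>l. 2 ^ l - 1) (2 * (C_GPF - 1)) \<and>
       (\<exists>e. e \<longlonglongrightarrow> 0 \<and>
         (\<forall>n\<ge>1. D n \<le> (2 * (C_GPF - 1) + e n) * (2 ^ n / real n))) \<and>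
       (\<exists>e. e \<longlonglongrightarrow> 0 \<and>
         (\<forall>l. D (2 ^ l) \<le> (C_GPF + e l) * (2 ^ (2 ^ l) / real (2 ^ l)))) \<and>
       (\<forall>\<^sub>F n in sequentially. normalized D n < 2 * (C_GPF - 1)))"
proof (intro conjI ballI)
  show "C_factor has_prod C_GPF"
    by (rule C_factor_has_prod)
  show "\<bar>C_GPF - 3.40147\<bar> < 0.000005"
    using C_GPF_bounds by simp
  fix D
  assume "D \<in> {\<lambda>n. real (Dz_GPF n), Dcnot_GPF \<kappa>}"
  then have "(\<lambda>n. real (n + 1) * (normalized D n - 2 * (real n * scaled_star n))) \<longlonglongrightarrow> 0"
    using Dz_GPF_perturbation Dcnot_GPF_perturbation[of \<kappa>, OF kappa] by auto
  note envelopes_of_perturbation[OF this]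
  then show "has_envelopes (normalized D) (\<lambda>l. 2 ^ l) C_GPF (\<lambda>l. 2 ^ l - 1) (2 * (C_GPF - 1))"
    and "\<exists>e. e \<longlonglongrightarrow> 0 \<and> (\<forall>n\<ge>1. D n \<le> (2 * (C_GPF - 1) + e n) * (2 ^ n / real n))"
    and "\<exists>e. e \<longlonglongrightarrow> 0 \<and> (\<forall>l. D (2 ^ l) \<le> (C_GPF + e l) * (2 ^ (2 ^ l) / real (2 ^ l)))"
    and "\<forall>\<^sub>F n in sequentially. normalized D n < 2 * (C_GPF - 1)"
    by blast+
qed

end
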